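(* Let $\Omega\in\mathbb{R}^{p\times d}$, let $m<d$ be a positive integer and let $0\le \ell\le p$ be an integer. Assume that $\kappa_\Omega(\ell)\le \frac{m}{2}$. Then for almost all $M\in\mathbb{R}^{m\times d}$ (with respect to Lebesgue measure on $\mathbb{R}^{m\times d}$), for every $y\in\mathbb{R}^m$ the linear inverse problem $y=Mx$ has at most one $\ell$-cosparse solution $x\in\mathbb{R}^d$.
   Context: For $\Lambda\subseteq\{1,\dots,p\}$, $\Omega_\Lambda$ denotes the submatrix of $\Omega$ formed by the rows indexed by $\Lambda$, and $\mathcal{W}_\Lambda:=\operatorname{Null}(\Omega_\Lambda)=\{x\in\mathbb{R}^d:\Omega_\Lambda x=0\}$ (with $\mathcal{W}_\emptyset=\mathbb{R}^d$). The function $\kappa_\Omega$ is defined by $$\kappa_\Omega(\ell):=\max_{\Lambda\subseteq\{1,\dots,p\},\ |\Lambda|\ge\ell}\dim(\mathcal{W}_\Lambda).$$ A vector $x$ is called $\ell$-cosparse (with respect to $\Omega$) if it lies in $\bigcup_{|\Lambda|=\ell}\mathcal{W}_\Lambda$, equivalently if $\Omega x$ has at least $\ell$ zero entries. *)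

theory Defs
  imports "HOL-Analysis.Analysis"
begin

text \<open>
  The null space of the submatrix of \<open>\<Omega>\<close> formed by the rows in \<open>\<Lambda>\<close>. A submatrix whose index set is
  an arbitrary subset of the type \<open>'p\<close> is not itself a matrix type, so the equation is imposed row
  by row; for empty \<open>\<Lambda>\<close> this is the whole space.
\<close>

definition null_rows :: "real^'d^'p \<Rightarrow> 'p set \<Rightarrow> (real^'d) set" where
  "null_rows \<Omega> \<Lambda> = {x. \<forall>i\<in>\<Lambda>. (\<Omega> *v x) $ i = 0}"

text \<open>The maximum is over a finite set, which is nonempty whenever \<open>l \<le> CARD('p)\<close>.\<close>

definition kappa :: "real^'d^'p \<Rightarrow> nat \<Rightarrow> nat" where
  "kappa \<Omega> l = Max {dim (null_rows \<Omega> \<Lambda>) | \<Lambda>. l \<le> card \<Lambda>}"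

definition cosparse :: "real^'d^'p \<Rightarrow> nat \<Rightarrow> real^'d \<Rightarrow> bool" where
  "cosparse \<Omega> l x \<longleftrightarrow> x \<in> (\<Union>\<Lambda>\<in>{\<Lambda>. card \<Lambda> = l}. null_rows \<Omega> \<Lambda>)"

lemma cosparse_iff_card_zeros:
  "cosparse \<Omega> l x \<longleftrightarrow> l \<le> card {i. (\<Omega> *v x) $ i = 0}"
proof
  assume "cosparse \<Omega> l x"
  then obtain \<Lambda> where "card \<Lambda> = l" "\<Lambda> \<subseteq> {i. (\<Omega> *v x) $ i = 0}"
    by (auto simp: cosparse_def null_rows_def)
  then show "l \<le> card {i. (\<Omega> *v x) $ i = 0}"
    using card_mono[OF finite] by blast
next
  assume "l \<le> card {i. (\<Omega> *v x) $ i = 0}"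
  then obtain \<Lambda> where "\<Lambda> \<subseteq> {i. (\<Omega> *v x) $ i = 0}" "card \<Lambda> = l"
    by (meson obtain_subset_with_card_n)
  then show "cosparse \<Omega> l x"
    by (auto simp: cosparse_def null_rows_def)
qed

end

theory Submission
  imports Defs
begin

text \<open>
  Two cosparse vectors differ by an element of \<open>W = \<W>\<^sub>\<Lambda> + \<W>\<^sub>\<Lambda>\<^sub>'\<close>, a subspace of dimension at most
  \<open>2 \<kappa> \<le> m\<close>, and there are finitely many such \<open>W\<close>. A matrix \<open>M\<close> that is not injective on \<open>W\<close> maps
  some member \<open>b\<close> of an orthonormal basis of \<open>W\<close> into the span of the images of the at most \<open>m - 1\<close>
  others. So \<open>M b\<close> is given by \<open>m - 1\<close> coefficients, and these matrices form the image of a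
  hyperplane under a polynomial map, hence a null set.
\<close>

text \<open>The rank-one matrix \<open>v w^T\<close>. For a unit vector \<open>w\<close>, adding it
  to a matrix shifts the image of \<open>w\<close> by \<open>v\<close> and leaves the images of
  vectors orthogonal to \<open>w\<close> unchanged.\<close>

definition outer_product :: "real^'m \<Rightarrow> real^'d \<Rightarrow> real^'d^'m" where
  "outer_product v w = (\<chi> r s. v $ r * w $ s)"

lemma outer_product_mult_vec: "outer_product v w *v x = (w \<bullet> x) *\<^sub>R v"
  by (simp add: outer_product_def matrix_vector_mult_def inner_vec_def vec_eq_iff
      sum_distrib_left sum_distrib_right mult_ac)

lemma linear_outer_product_left: "linear (\<lambda>v. outer_product v w)"
  by (rule linearI) (simp_all add: outer_product_def vec_eq_iff algebra_simps)

lemma outer_product_inner: "outer_product v w \<bullet> M = v \<bullet> (M *v w)"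
  by (simp add: outer_product_def matrix_vector_mult_def inner_vec_def sum_distrib_left mult_ac)

lemma linear_matrix_vector_mult_left: "linear (\<lambda>M :: real^'d^'m. M *v x)"
  by (rule linearI) (simp_all add: matrix_vector_mult_add_rdistrib scaleR_matrix_vector_assoc)

text \<open>The entry is a linear functional of \<open>M\<close>, namely the inner product with a
  rank-one matrix that is nonzero because \<open>b\<close> is, so its zero set is a
  hyperplane.\<close>

lemma negligible_mult_vec_component_eq_0:
  assumes "b \<noteq> 0"
  shows "negligible {M :: real^'d^'m. (M *v b) $ r = 0}"
proof -
  let ?a = "outer_product (axis r 1) b :: real^'d^'m"
  have "?a *v b \<noteq> 0"
    using assms by (simp add: outer_product_mult_vec axis_eq_0_iff)
  then have "?a \<noteq> 0"
    by auto
  moreover have "{M :: real^'d^'m. (M *v b) $ r = 0} = {M. ?a \<bullet> M = 0}"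
    by (simp add: outer_product_inner inner_axis')
  ultimately show ?thesis
    using negligible_hyperplane by metis
qed

lemma negligible_image_in_span:
  fixes B :: "(real^'d) set"
  assumes orth: "pairwise orthogonal B" and norm: "\<And>x. x \<in> B \<Longrightarrow> norm x = 1"
    and fin: "finite B" and card: "card B \<le> CARD('m::finite)" and b: "b \<in> B"
  shows "negligible {M :: real^'d^'m. \<exists>c. M *v b = (\<Sum>x\<in>B-{b}. c x *\<^sub>R (M *v x))}"
proof -
  \<comment> \<open>Any coordinate \<open>r\<close> will do: it is kept free of coefficients, and
    since \<open>B - {b}\<close> has at most \<open>CARD('m) - 1\<close> elements, the other
    coordinates have room for one coefficient each.\<close>
  fix r :: 'm
  have "card (B - {b}) \<le> card (UNIV - {r})"
    using card b fin by simp
  then obtain g where g: "g ` (B - {b}) \<subseteq> UNIV - {r}" "inj_on g (B - {b})"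
    using fin by (meson card_le_inj finite finite_Diff)
  have bb: "b \<bullet> b = 1"
    using norm[OF b] by (simp add: norm_eq_1)
  have bx: "b \<bullet> x = 0" if "x \<in> B - {b}" for x
    using orth b that by (auto simp: pairwise_def orthogonal_def)
  \<comment> \<open>On the hyperplane, the vector \<open>N b\<close> stores the coefficients; the map replaces it by the
    corresponding combination of the vectors \<open>N x\<close>.\<close>
  define f :: "real^'d^'m \<Rightarrow> real^'d^'m" where
    "f N = N - outer_product (N *v b) b + 
      (\<Sum>x\<in>B-{b}. (N *v b) $ g x *\<^sub>R outer_product (N *v x) b)" for N
  let ?H = "{N :: real^'d^'m. (N *v b) $ r = 0}"
  have lin1: "(\<lambda>N :: real^'d^'m. outer_product (N *v x) b) differentiable F" for x F
    using linear_compose[OF linear_matrix_vector_mult_left linear_outer_product_left]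
    by (intro linear_imp_differentiable) (simp add: o_def)
  have lin2: "(\<lambda>N :: real^'d^'m. (N *v b) $ s) differentiable F" for s F
    using linear_compose[OF linear_matrix_vector_mult_left bounded_linear.linear[OF bounded_linear_vec_nth]]
    by (intro linear_imp_differentiable) (simp add: o_def)
  have "f differentiable_on ?H"
    unfolding f_def differentiable_on_def
    by (intro ballI differentiable_add differentiable_diff differentiable_sum differentiable_scaleR
        differentiable_ident lin1 lin2) (use fin in auto)
  moreover have "negligible ?H"
    using bb by (intro negligible_mult_vec_component_eq_0) auto
  \<comment> \<open>\<open>f\<close> maps the matrix space to itself, so domain and target have
    equal dimension and a differentiable image of a null set is null.\<close>
  ultimately have "negligible (f ` ?H)"
    by (intro negligible_differentiable_image_negligible) auto
  moreover have "{M. \<exists>c. M *v b = (\<Sum>x\<in>B-{b}. c x *\<^sub>R (M *v x))} \<subseteq> f ` ?H"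
  proof clarify
    fix M :: "real^'d^'m" and c
    assume c: "M *v b = (\<Sum>x\<in>B-{b}. c x *\<^sub>R (M *v x))"
    \<comment> \<open>The coefficient \<open>c x\<close> goes to coordinate \<open>g x\<close>. The
      default 0 applies at \<open>r\<close>, which \<open>g\<close> avoids, and this puts
      \<open>N\<close> on the hyperplane.\<close>
    define v :: "real^'m" where
      "v = (\<chi> s. if s \<in> g ` (B - {b}) then c (the_inv_into (B - {b}) g s) else 0)"
    \<comment> \<open>The preimage of \<open>M\<close> under \<open>f\<close>: it sends
      \<open>b\<close> to \<open>v\<close> and agrees with \<open>M\<close> on the orthogonal
      complement of \<open>b\<close>, in particular on \<open>B - {b}\<close>.\<close>
    define N where "N = M - outer_product (M *v b) b + outer_product v b"
    have N: "N *v x = M *v x + (b \<bullet> x) *\<^sub>R (v - M *v b)" for x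
      by (simp add: N_def outer_product_mult_vec matrix_vector_mult_add_rdistrib
          matrix_vector_mult_diff_rdistrib algebra_simps)
    have vg: "v $ g x = c x" if "x \<in> B - {b}" for x
      using that g(2) by (simp add: v_def the_inv_into_f_f)
    have Nb: "N *v b = v"
      by (simp add: N bb)
    have "(\<Sum>x\<in>B-{b}. (N *v b) $ g x *\<^sub>R outer_product (N *v x) b)
        = (\<Sum>x\<in>B-{b}. c x *\<^sub>R outer_product (M *v x) b)"
      using vg bx by (intro sum.cong) (simp_all add: Nb, simp add: N)
    also have "\<dots> = outer_product (M *v b) b"
      unfolding c by (simp add: linear_sum[OF linear_outer_product_left]
          linear_scale[OF linear_outer_product_left])
    finally have "f N = M"
      unfolding f_def Nb by (simp add: N_def)
    moreover have "N \<in> ?H"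
      using g(1) by (auto simp: Nb v_def)
    ultimately show "M \<in> f ` ?H"
      by blast
  qed
  ultimately show ?thesis
    using negligible_subset by blast
qed

lemma negligible_not_injective_on_subspace:
  fixes V :: "(real^'d) set"
  assumes "subspace V" and "dim V \<le> CARD('m::finite)"
  shows "negligible {M :: real^'d^'m. \<exists>x\<in>V. x \<noteq> 0 \<and> M *v x = 0}"
proof -
  obtain B where B: "pairwise orthogonal B" "\<And>x. x \<in> B \<Longrightarrow> norm x = 1" "independent B"
      "card B = dim V" "span B = V"
    using orthonormal_basis_subspace[OF assms(1)] by metis
  have fin: "finite B"
    using B(3) independent_imp_finite by blast
  let ?S = "\<lambda>b. {M :: real^'d^'m. \<exists>c. M *v b = (\<Sum>x\<in>B-{b}. c x *\<^sub>R (M *v x))}"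
  have "negligible (\<Union>b\<in>B. ?S b)"
    using negligible_image_in_span[OF B(1,2) fin] B(4) assms(2) fin
    by (intro negligible_Union) auto
  moreover have "{M :: real^'d^'m. \<exists>x\<in>V. x \<noteq> 0 \<and> M *v x = 0} \<subseteq> (\<Union>b\<in>B. ?S b)"
  proof clarify
    fix M :: "real^'d^'m" and x
    assume x: "x \<in> V" "x \<noteq> 0" "M *v x = 0"
    then obtain u where u: "x = (\<Sum>w\<in>B. u w *\<^sub>R w)"
      using B(5) span_finite[OF fin] by auto
    \<comment> \<open>Dividing by this nonzero coefficient solves the relation
      \<open>M *v x = 0\<close> for \<open>M *v b\<close>.\<close>
    with x(2) obtain b where b: "b \<in> B" "u b \<noteq> 0"
      by (metis (no_types, lifting) scaleR_eq_0_iff sum.neutral)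
    have "0 = (\<Sum>w\<in>B. u w *\<^sub>R (M *v w))"
      using x(3) unfolding u
      by (simp add: linear_sum[OF matrix_vector_mul_linear] linear_scale[OF matrix_vector_mul_linear])
    also have "\<dots> = u b *\<^sub>R (M *v b) + (\<Sum>w\<in>B-{b}. u w *\<^sub>R (M *v w))"
      using fin b(1) by (rule sum.remove)
    finally have "u b *\<^sub>R (M *v b) = - (\<Sum>w\<in>B-{b}. u w *\<^sub>R (M *v w))"
      by (simp add: eq_neg_iff_add_eq_0)
    then have "inverse (u b) *\<^sub>R u b *\<^sub>R (M *v b)
        = inverse (u b) *\<^sub>R - (\<Sum>w\<in>B-{b}. u w *\<^sub>R (M *v w))"
      by simp
    then have "M *v b = (\<Sum>w\<in>B-{b}. (- u w / u b) *\<^sub>R (M *v w))"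
      using b(2) by (simp add: scaleR_sum_right sum_negf[symmetric] divide_inverse mult_ac)
    then have "M \<in> ?S b"
      by (intro CollectI exI[of _ "\<lambda>w. - u w / u b"])
    with b(1) show "M \<in> (\<Union>b\<in>B. ?S b)"
      by blast
  qed
  ultimately show ?thesis
    using negligible_subset by blast
qed

lemma subspace_null_rows: "subspace (null_rows \<Omega> \<Lambda>)"
  by (auto simp: subspace_def null_rows_def matrix_vector_right_distrib matrix_vector_mult_scaleR)

lemma dim_null_rows_le_kappa:
  assumes "l \<le> card \<Lambda>"
  shows "dim (null_rows \<Omega> \<Lambda>) \<le> kappa \<Omega> l"
  unfolding kappa_def by (rule Max_ge) (use assms in auto)

theorem proposition3:
  fixes \<Omega> :: "real^'d^'p" and l :: nat
  assumes "CARD('m::finite) < CARD('d)"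
    and "l \<le> CARD('p)"
    and "real (kappa \<Omega> l) \<le> real CARD('m) / 2"
  shows "AE M in (lebesgue :: (real^'d^'m) measure).
           \<forall>y. \<exists>\<^sub>\<le>\<^sub>1 x. M *v x = y \<and> cosparse \<Omega> l x"
proof -
  let ?W = "\<lambda>(\<Lambda>, \<Lambda>'). {x + y | x y. x \<in> null_rows \<Omega> \<Lambda> \<and> y \<in> null_rows \<Omega> \<Lambda>'}"
  let ?bad = "\<lambda>V. {M :: real^'d^'m. \<exists>x\<in>V. x \<noteq> 0 \<and> M *v x = 0}"
  let ?P = "{\<Lambda>. card \<Lambda> = l} \<times> {\<Lambda>. card \<Lambda> = l}"
  have "negligible (?bad (?W p))" if mem: "p \<in> ?P" for p
  proof -
    obtain \<Lambda> \<Lambda>' where p: "p = (\<Lambda>, \<Lambda>')" "card \<Lambda> = l" "card \<Lambda>' = l"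
      using mem by auto
    have "dim (?W p) \<le> dim (null_rows \<Omega> \<Lambda>) + dim (null_rows \<Omega> \<Lambda>')"
      using dim_sums_Int[OF subspace_null_rows[of \<Omega> \<Lambda>] subspace_null_rows[of \<Omega> \<Lambda>']]
      by (simp add: p(1))
    \<comment> \<open>Each summand is at most \<open>kappa \<Omega> l\<close>, hence at most half of
      \<open>CARD('m)\<close>.\<close>
    also have "\<dots> \<le> CARD('m)"
      using dim_null_rows_le_kappa[of l \<Lambda> \<Omega>] dim_null_rows_le_kappa[of l \<Lambda>' \<Omega>] p assms(3)
      by simp
    finally show ?thesis
      using subspace_sums[OF subspace_null_rows[of \<Omega> \<Lambda>] subspace_null_rows[of \<Omega> \<Lambda>']]
      by (intro negligible_not_injective_on_subspace) (simp_all add: p(1))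
  qed
  then have "negligible (\<Union>p\<in>?P. ?bad (?W p))"
    by (intro negligible_Union) auto
  moreover have "{M :: real^'d^'m. \<not> (\<forall>y. \<exists>\<^sub>\<le>\<^sub>1 x. M *v x = y \<and> cosparse \<Omega> l x)}
      \<subseteq> (\<Union>p\<in>?P. ?bad (?W p))"
  proof (intro subsetI, elim CollectE)
    fix M :: "real^'d^'m"
    assume "\<not> (\<forall>y. \<exists>\<^sub>\<le>\<^sub>1 x. M *v x = y \<and> cosparse \<Omega> l x)"
    then obtain x x' where x: "M *v x = M *v x'" "cosparse \<Omega> l x" "cosparse \<Omega> l x'" "x \<noteq> x'"
      by (auto simp: Uniq_def)
    then obtain \<Lambda> \<Lambda>' where p: "(\<Lambda>, \<Lambda>') \<in> ?P" "x \<in> null_rows \<Omega> \<Lambda>" "x' \<in> null_rows \<Omega> \<Lambda>'"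
      by (auto simp: cosparse_def)
    \<comment> \<open>The difference is written as a sum to match the form of the elements of
      \<open>?W\<close>.\<close>
    have "x + - x' \<in> ?W (\<Lambda>, \<Lambda>')"
      using p(2) subspace_neg[OF subspace_null_rows p(3)] by blast
    moreover have "x + - x' \<noteq> 0" "M *v (x + - x') = 0"
      using x by (simp_all add: matrix_vector_mult_diff_distrib)
    ultimately have "M \<in> ?bad (?W (\<Lambda>, \<Lambda>'))"
      by blast
    with p(1) show "M \<in> (\<Union>p\<in>?P. ?bad (?W p))"
      by (rule UN_I)
  qed
  ultimately show ?thesis
    \<comment> \<open>Containment of the exceptional set in a null set suffices, so its
      measurability is never at issue.\<close>
    unfolding negligible_iff_null_sets by (intro AE_I') simp_all
qed

end
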